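(* Let $X_1,\dots,X_n,Z$ be absolutely continuous random variables. Let $C$ be the copula of $(X_1,\dots,X_n,Z)$ and let $C_{X_i,Z}$ be the copula of $(X_i,Z)$, $i=1,\dots,n$. Write $\dot C(u_1,\dots,u_n,w)=\frac{\partial}{\partial w}C(u_1,\dots,u_n,w)$ and $\dot C_{X_i,Z}(u,w)=\frac{\partial}{\partial w}C_{X_i,Z}(u,w)$. Then $X_1,\dots,X_n$ are conditionally independent given $Z$ if and only if $$\dot C(u_1,\dots,u_n,w)=\prod_{i=1}^n\dot C_{X_i,Z}(u_i,w)\qquad\text{for all }0\le u_1,\dots,u_n,w\le 1.$$
   Context: Let $F_{X_i}$ and $F_Z$ be the distribution functions of $X_i$ and $Z$. The copula $C$ is the distribution function on $[0,1]^{n+1}$ with uniform margins such that $P\{X_1\le x_1,\dots,X_n\le x_n,Z\le z\}=C(F_{X_1}(x_1),\dots,F_{X_n}(x_n),F_Z(z))$ for all real $x_1,\dots,x_n,z$; similarly $P\{X_i\le x,Z\le z\}=C_{X_i,Z}(F_{X_i}(x),F_Z(z))$. The random variables $X_1,\dots,X_n$ are said to be conditionally independent given $Z$ if $$P\{X_1\le x_1,\dots,X_n\le x_n\mid Z=z\}=\prod_{i=1}^nP\{X_i\le x_i\mid Z=z\}$$ for all $(x_1,\dots,x_n,z)\in\mathbb{R}^{n+1}$.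
   Formalization: The identity is required for every u but only for almost every w (where the partial derivatives exist), since copula derivatives in w need not exist everywhere; the conditional independence identity is required, for each x, for almost every z with respect to the law of Z. *)

theory Defs
  imports "HOL-Probability.Probability"
begin

text \<open>Arguments of \<open>C\<close> are families \<open>u\<close> indexed by \<open>I\<close>; only the values \<open>u i\<close> with \<open>i \<in> I\<close> matter,
  and nothing is said about \<open>C\<close> outside the unit cube.\<close>

definition copula :: "'i set \<Rightarrow> (('i \<Rightarrow> real) \<Rightarrow> real) \<Rightarrow> bool" where
  "copula I C \<longleftrightarrow> finite I \<and>
     (\<exists>\<mu>. prob_space \<mu> \<and> sets \<mu> = sets (PiM I (\<lambda>_. borel)) \<and>
          (\<forall>i\<in>I. distr \<mu> borel (\<lambda>y. y i) = uniform_measure lborel {0..1}) \<and>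
          (\<forall>u. (\<forall>i\<in>I. u i \<in> {0..1}) \<longrightarrow> C u = measure \<mu> {y \<in> space \<mu>. \<forall>i\<in>I. y i \<le> u i}))"

definition copula_of ::
    "'a measure \<Rightarrow> 'i set \<Rightarrow> ('i \<Rightarrow> 'a \<Rightarrow> real) \<Rightarrow> (('i \<Rightarrow> real) \<Rightarrow> real) \<Rightarrow> bool" where
  "copula_of M I Y C \<longleftrightarrow> copula I C \<and>
     (\<forall>x. measure M {\<omega> \<in> space M. \<forall>i\<in>I. Y i \<omega> \<le> x i}
          = C (\<lambda>i. cdf (distr M borel (Y i)) (x i)))"

text \<open>\<open>cond_prob_at M Z A z\<close> is \<open>P(A | Z = z)\<close>: the density of \<open>B \<mapsto> P(A \<inter> {Z \<in> B})\<close> with respect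
  to the law of \<open>Z\<close>, hence determined only up to null sets of that law.\<close>

definition cond_prob_at :: "'a measure \<Rightarrow> ('a \<Rightarrow> real) \<Rightarrow> 'a set \<Rightarrow> real \<Rightarrow> real" where
  "cond_prob_at M Z A z =
     enn2real (RN_deriv (distr M borel Z) (distr (density M (indicator A)) borel Z) z)"

text \<open>Since each conditional probability is defined only up to a null set, the identity is required,
  for every \<open>x\<close>, for almost every \<open>z\<close>; the exceptional set may depend on \<open>x\<close>.\<close>

definition cond_indep_given :: "'a measure \<Rightarrow> nat \<Rightarrow> (nat \<Rightarrow> 'a \<Rightarrow> real) \<Rightarrow> ('a \<Rightarrow> real) \<Rightarrow> bool" where
  "cond_indep_given M n X Z \<longleftrightarrow>
     (\<forall>x::nat \<Rightarrow> real. AE z in distr M borel Z.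
        cond_prob_at M Z {\<omega> \<in> space M. \<forall>i\<in>{1..n}. X i \<omega> \<le> x i} z
        = (\<Prod>i=1..n. cond_prob_at M Z {\<omega> \<in> space M. X i \<omega> \<le> x i} z))"

end

theory Submission
  imports Defs
begin

text \<open>
  Fix \<open>u\<close> in the unit cube. As a function of its last argument, \<open>C\<close> is the distribution
  function of a measure on \<open>[0,1]\<close> dominated by Lebesgue measure, so it is the integral
  of a density \<open>c u\<close> with values in \<open>[0,1]\<close>, and by Lebesgue's differentiation theorem its
  derivative is \<open>c u\<close> almost everywhere. Likewise \<open>D i a\<close> has a density \<open>d i a\<close>. Hence the
  derivative identity at \<open>u\<close> says that \<open>c u\<close> is almost everywhere the product of the
  \<open>d i (u i)\<close>, in other words that this product is a density of the slice of \<open>C\<close> at \<open>u\<close>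
  (\<open>unit_density_prod_iff_deriv\<close>).

  On the probabilistic side, let \<open>F\<close> be the distribution function of \<open>Z\<close>. It is continuous, so
  \<open>F(Z)\<close> is uniform, and substituting \<open>w = F(z)\<close> shows that for \<open>u i = F\<^sub>i(x i)\<close>, where
  \<open>F\<^sub>i\<close> is the distribution function of \<open>X i\<close>, the conditional probability of
  \<open>X 1 \<le> x 1, ..., X n \<le> x n\<close> given \<open>Z = z\<close> is \<open>c u (F z)\<close>
  (\<open>cond_prob_at_eq_density\<close>). Conditional independence is therefore the same factorization of
  \<open>c u\<close>, but only for those \<open>u\<close> whose coordinates are values of the distribution functions.

  By the intermediate value theorem these \<open>u\<close> include the open cube, but possibly no boundary
  point. The gap is closed by continuity: moving \<open>u\<close> changes \<open>C\<close> by at most the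
  \<open>\<ell>\<^sub>1\<close>-distance of the arguments, and changes \<open>d i (u i)\<close> in \<open>L\<^sup>1\<close> by at most the distance
  of the \<open>i\<close>-th coordinates, because the densities increase with \<open>u i\<close> and their total mass
  is \<open>u i\<close>. So the integrated factorization passes to the closed cube
  (\<open>slice_factorization_closed_cube\<close>).
\<close>

section \<open>Lebesgue differentiation on the line\<close>

text \<open>
  If the difference quotients at \<open>x\<close> stay \<open>\<eta>\<close> away from \<open>f x\<close> at arbitrarily small scales, the
  bad intervals with endpoint \<open>x\<close> are fine for any gauge and cover the set of such \<open>x\<close> in
  Vitali's sense. Disjoint bad intervals, tagged by \<open>x\<close>, form a partial division, on which
  Henstock's lemma bounds the sum of the errors; each error exceeds \<open>\<eta>\<close> times the length, so the
  total length is as small as desired.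
\<close>

lemma negligible_non_lebesgue_points:
  fixes f :: "real \<Rightarrow> real"
  assumes f: "f integrable_on {a..b}" and "\<eta> > 0"
  shows "negligible {x \<in> {a<..<b}. \<forall>\<delta>>0. \<exists>y\<in>{a<..<b}. y \<noteq> x \<and> \<bar>y - x\<bar> < \<delta> \<and>
           \<eta> * \<bar>y - x\<bar> < \<bar>\<bar>y - x\<bar> * f x - integral {min x y..max x y} f\<bar>}"
    (is "negligible ?E")
  unfolding negligible_outer_le
proof (intro allI impI)
  fix e :: real assume "e > 0"
  let ?J = "\<lambda>(x::real, y). {min x y..max x y}"
  \<comment> \<open>Vitali's theorem is about balls, Henstock's lemma about intervals.\<close>
  have J_cball: "cball ((fst p + snd p) / 2) (\<bar>snd p - fst p\<bar> / 2) = ?J p" for p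
    by (cases p) (auto simp: cball_eq_atLeastAtMost min_def max_def field_simps)
  have J_length: "measure lebesgue (?J p) = \<bar>snd p - fst p\<bar>" "measure lborel (?J p) = \<bar>snd p - fst p\<bar>"
    for p by (cases p; cases "fst p \<le> snd p"; simp)+
  have f': "f integrable_on cbox a b" using f by simp
  have "e * \<eta> > 0" using \<open>e > 0\<close> \<open>\<eta> > 0\<close> by simp
  from Henstock_lemma[OF f' this] obtain \<gamma> where \<gamma>: "gauge \<gamma>"
    "\<And>p. \<lbrakk>p tagged_partial_division_of (cbox a b); \<gamma> fine p\<rbrakk> \<Longrightarrow>
       (\<Sum>(x,k)\<in>p. norm (measure lborel k *\<^sub>R f x - integral k f)) < e * \<eta>" by blast
  define K where "K = {(x,y). x \<in> {a<..<b} \<and> y \<in> {a<..<b} \<and> y \<noteq> x \<and> ?J (x,y) \<subseteq> \<gamma> x \<and>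
           \<eta> * \<bar>y - x\<bar> < \<bar>\<bar>y - x\<bar> * f x - integral (?J (x,y)) f\<bar>}"
  have fine_cover: "\<exists>p. p \<in> K \<and> x \<in> cball ((fst p + snd p) / 2) (\<bar>snd p - fst p\<bar> / 2) \<and>
      \<bar>snd p - fst p\<bar> / 2 < d" if x: "x \<in> ?E" and "d > 0" for x d
  proof -
    obtain r where r: "r > 0" "ball x r \<subseteq> \<gamma> x"
      using \<gamma>(1) unfolding gauge_def by (meson openE)
    have "min d r > 0" using r \<open>d > 0\<close> by simp
    with x obtain y where y: "y \<in> {a<..<b}" "y \<noteq> x" "\<bar>y - x\<bar> < min d r"
      "\<eta> * \<bar>y - x\<bar> < \<bar>\<bar>y - x\<bar> * f x - integral {min x y..max x y} f\<bar>" by blast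
    have "{min x y..max x y} \<subseteq> ball x r" using y(3) by (auto simp: dist_real_def)
    hence "(x, y) \<in> K" using x y r by (auto simp: K_def)
    moreover have "x \<in> ?J (x, y)" by simp
    ultimately show ?thesis using y(3) \<open>d > 0\<close> unfolding J_cball
      by (intro exI[of _ "(x, y)"]) auto
  qed
  obtain \<C> where \<C>: "countable \<C>" "\<C> \<subseteq> K"
    "pairwise (\<lambda>i j. disjnt (?J i) (?J j)) \<C>" "negligible (?E - (\<Union>i\<in>\<C>. ?J i))"
  proof (rule Vitali_covering_theorem_cballs[where K = K and S = ?E
        and a = "\<lambda>p. (fst p + snd p) / 2" and r = "\<lambda>p. \<bar>snd p - fst p\<bar> / 2"])
    show "0 < \<bar>snd p - fst p\<bar> / 2" if "p \<in> K" for p using that by (auto simp: K_def)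
  qed (use fine_cover that in \<open>simp_all only: J_cball\<close>)
  have finite_bound: "(\<Sum>p\<in>\<F>. measure lebesgue (?J p)) \<le> e" if "finite \<F>" "\<F> \<subseteq> \<C>" for \<F>
  proof -
    let ?t = "\<lambda>p. (fst p, ?J p)"
    have inj: "inj_on ?J \<F>"
    proof (rule inj_onI)
      fix p q assume "p \<in> \<F>" "q \<in> \<F>" and eq: "?J p = ?J q"
      show "p = q"
      proof (rule ccontr)
        assume "p \<noteq> q"
        hence "disjnt (?J p) (?J q)"
          using \<C>(3) \<open>\<F> \<subseteq> \<C>\<close> \<open>p \<in> \<F>\<close> \<open>q \<in> \<F>\<close> unfolding pairwise_def by blast
        with eq show False by (cases q) (auto simp: disjnt_def)
      qed
    qed
    hence inj_t: "inj_on ?t \<F>" by (auto simp: inj_on_def)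
    have "?t ` \<F> tagged_partial_division_of cbox a b"
      unfolding tagged_partial_division_of_def
    proof (intro conjI allI impI)
      show "finite (?t ` \<F>)" using that by simp
    next
      fix x k assume "(x, k) \<in> ?t ` \<F>"
      then obtain y where p: "(x, y) \<in> \<F>" "k = ?J (x, y)" by auto
      have "(x, y) \<in> K" using p that \<C>(2) by blast
      thus "x \<in> k" "k \<subseteq> cbox a b" "\<exists>a b. k = cbox a b" using p by (auto simp: K_def cbox_interval)
    next
      fix x1 k1 x2 k2
      assume "(x1, k1) \<in> ?t ` \<F> \<and> (x2, k2) \<in> ?t ` \<F> \<and> (x1, k1) \<noteq> (x2, k2)"
      then obtain p q where "p \<in> \<F>" "q \<in> \<F>" "p \<noteq> q" "k1 = ?J p" "k2 = ?J q" by blast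
      hence "disjnt k1 k2" using \<C>(3) \<open>\<F> \<subseteq> \<C>\<close> unfolding pairwise_def by blast
      thus "interior k1 \<inter> interior k2 = {}"
        using interior_subset unfolding disjnt_def by blast
    qed
    moreover have "\<gamma> fine ?t ` \<F>"
      using that \<C>(2) unfolding fine_def K_def by fastforce
    ultimately have H: "(\<Sum>(x,k)\<in>?t ` \<F>. norm (measure lborel k *\<^sub>R f x - integral k f)) < e * \<eta>"
      by (rule \<gamma>(2))
    have "\<eta> * (\<Sum>p\<in>\<F>. measure lebesgue (?J p)) = (\<Sum>p\<in>\<F>. \<eta> * \<bar>snd p - fst p\<bar>)"
      unfolding sum_distrib_left
      unfolding J_length(1) ..
    also have "\<dots> \<le> (\<Sum>p\<in>\<F>. norm (measure lborel (?J p) *\<^sub>R f (fst p) - integral (?J p) f))"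
    proof (rule sum_mono)
      fix p assume "p \<in> \<F>"
      hence "p \<in> K" using that \<C>(2) by blast
      thus "\<eta> * \<bar>snd p - fst p\<bar> \<le> norm (measure lborel (?J p) *\<^sub>R f (fst p) - integral (?J p) f)"
        unfolding J_length(2) by (cases p) (simp add: K_def)
    qed
    also have "\<dots> = (\<Sum>(x,k)\<in>?t ` \<F>. norm (measure lborel k *\<^sub>R f x - integral k f))"
      by (subst sum.reindex[OF inj_t]) simp
    finally have "\<eta> * (\<Sum>p\<in>\<F>. measure lebesgue (?J p)) \<le> \<eta> * e" using H by (simp add: mult.commute)
    thus ?thesis using \<open>\<eta> > 0\<close> by simp
  qed
  have Union_bound: "measure lebesgue (\<Union>\<F>) \<le> e" if \<F>: "\<F> \<subseteq> ?J ` \<C>" "finite \<F>" for \<F>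
  proof -
    obtain \<G> where \<G>: "\<G> \<subseteq> \<C>" "finite \<G>" "\<F> = ?J ` \<G>"
      using finite_subset_image[OF \<F>(2,1)] by blast
    have "measure lebesgue (\<Union>\<F>) \<le> (\<Sum>p\<in>\<G>. measure lebesgue (?J p))"
      unfolding \<G>(3) using \<G>(2) by (rule measure_UNION_le) (simp add: case_prod_unfold)
    thus ?thesis using finite_bound[OF \<G>(2,1)] by linarith
  qed
  let ?U = "\<Union>(?J ` \<C>)"
  have meas: "?U \<in> lmeasurable" "measure lebesgue ?U \<le> e"
  proof -
    have "countable (?J ` \<C>)" "\<And>D. D \<in> ?J ` \<C> \<Longrightarrow> D \<in> lmeasurable"
      using \<C>(1) by auto
    from fmeasurable_Union_bound[OF this Union_bound] measure_Union_bound[OF this Union_bound]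
    show "?U \<in> lmeasurable" "measure lebesgue ?U \<le> e" by blast+
  qed
  define V where "V = ?E - ?U"
  have V: "V \<in> lmeasurable" "measure lebesgue V = 0"
    using \<C>(4) negligible_imp_measurable negligible_imp_measure0 unfolding V_def by blast+
  have "measure lebesgue (?U \<union> V) \<le> measure lebesgue ?U + measure lebesgue V"
    by (rule measure_Un_le[OF fmeasurableD[OF meas(1)] fmeasurableD[OF V(1)]])
  with meas(2) V(2) have "measure lebesgue (?U \<union> V) \<le> e" by linarith
  moreover have "?U \<union> V \<in> lmeasurable" by (rule fmeasurable.Un[OF meas(1) V(1)])
  moreover have "?E \<subseteq> ?U \<union> V" unfolding V_def by blast
  ultimately show "\<exists>T. ?E \<subseteq> T \<and> T \<in> lmeasurable \<and> measure lebesgue T \<le> e"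
    by blast
qed

text \<open>
  The derivative can fail to be \<open>f x\<close> only if \<open>x\<close> is bad for some \<open>\<eta> = 1 / (k + 1)\<close>, and
  these countably many bad sets are negligible.
\<close>

theorem lebesgue_differentiation_indefinite_integral:
  fixes f :: "real \<Rightarrow> real"
  assumes f: "f integrable_on {a..b}"
  shows "AE x in lborel. x \<in> {a<..<b} \<longrightarrow>
           ((\<lambda>t. integral {a..t} f) has_real_derivative f x) (at x)"
proof -
  define E where "E = (\<lambda>\<eta>. {x \<in> {a<..<b}. \<forall>\<delta>>0. \<exists>y\<in>{a<..<b}. y \<noteq> x \<and> \<bar>y - x\<bar> < \<delta> \<and>
           \<eta> * \<bar>y - x\<bar> < \<bar>\<bar>y - x\<bar> * f x - integral {min x y..max x y} f\<bar>})"
  have "negligible (\<Union>k. E (inverse (real (Suc k))))"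
    unfolding E_def
    by (rule negligible_Union_nat, rule negligible_non_lebesgue_points[OF f]) simp
  hence "AE x in lebesgue. x \<notin> (\<Union>k. E (inverse (real (Suc k))))"
    by (intro AE_not_in) (simp add: negligible_iff_null_sets)
  hence "AE x in lborel. x \<notin> (\<Union>k. E (inverse (real (Suc k))))"
    by (simp add: AE_completion_iff)
  thus ?thesis
  proof (rule eventually_mono, intro impI)
    fix x assume x: "x \<notin> (\<Union>k. E (inverse (real (Suc k))))" "x \<in> {a<..<b}"
    have diff: "\<bar>\<bar>y - x\<bar> * f x - integral {min x y..max x y} f\<bar>
        = \<bar>integral {a..y} f - integral {a..x} f - f x * (y - x)\<bar>" if "y \<in> {a<..<b}" for y
    proof (cases "x \<le> y")
      case True
      have "integral {a..x} f + integral {x..y} f = integral {a..y} f"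
        using x that True
        by (intro Henstock_Kurzweil_Integration.integral_combine integrable_subinterval_real[OF f]) auto
      thus ?thesis using True by (simp add: algebra_simps abs_minus_commute)
    next
      case False
      have "integral {a..y} f + integral {y..x} f = integral {a..x} f"
        using x that False
        by (intro Henstock_Kurzweil_Integration.integral_combine integrable_subinterval_real[OF f]) auto
      thus ?thesis using False by (simp add: algebra_simps abs_minus_commute)
    qed
    show "((\<lambda>t. integral {a..t} f) has_real_derivative f x) (at x)"
      unfolding has_field_derivative_def has_derivative_within_alt
    proof (intro conjI allI impI)
      show "bounded_linear ((*) (f x))" by (rule bounded_linear_mult_right)
    next
      fix e :: real assume "e > 0"
      then obtain k where k: "inverse (real (Suc k)) < e" using reals_Archimedean by blast
      from x have "x \<notin> E (inverse (real (Suc k)))" by blast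
      hence "\<exists>\<delta>>0. \<forall>y\<in>{a<..<b}. y \<noteq> x \<longrightarrow> \<bar>y - x\<bar> < \<delta> \<longrightarrow>
         \<bar>\<bar>y - x\<bar> * f x - integral {min x y..max x y} f\<bar> \<le> inverse (real (Suc k)) * \<bar>y - x\<bar>"
        using x(2) unfolding E_def mem_Collect_eq by (meson not_less)
      then obtain \<delta> where \<delta>: "\<delta> > 0" "\<And>y. y \<in> {a<..<b} \<Longrightarrow> y \<noteq> x \<Longrightarrow> \<bar>y - x\<bar> < \<delta> \<Longrightarrow>
         \<bar>\<bar>y - x\<bar> * f x - integral {min x y..max x y} f\<bar> \<le> inverse (real (Suc k)) * \<bar>y - x\<bar>"
        by blast
      let ?d = "min \<delta> (min (x - a) (b - x))"
      show "\<exists>d>0. \<forall>y\<in>UNIV. norm (y - x) < d \<longrightarrow>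
          norm (integral {a..y} f - integral {a..x} f - f x * (y - x)) \<le> e * norm (y - x)"
      proof (intro exI[of _ ?d] conjI ballI impI)
        show "?d > 0" using \<delta> x by auto
        fix y assume y: "norm (y - x) < ?d"
        hence y': "y \<in> {a<..<b}" by auto
        show "norm (integral {a..y} f - integral {a..x} f - f x * (y - x)) \<le> e * norm (y - x)"
        proof (cases "y = x")
          case False
          have "\<bar>integral {a..y} f - integral {a..x} f - f x * (y - x)\<bar>
              \<le> inverse (real (Suc k)) * \<bar>y - x\<bar>"
            using \<delta>(2)[OF y' False] y diff[OF y'] by auto
          also have "\<dots> \<le> e * \<bar>y - x\<bar>" using k by (intro mult_right_mono) auto
          finally show ?thesis by simp
        qed simp
      qed
    qed
  qed
qed

section \<open>Densities on the unit interval\<close>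

text \<open>
  The bounds are imposed everywhere, not just almost everywhere, so that products of such densities
  are again bounded by one. Nothing is required of \<open>F\<close> outside the unit interval, where a copula
  is unconstrained.
\<close>

definition unit_density :: "(real \<Rightarrow> real) \<Rightarrow> (real \<Rightarrow> real) \<Rightarrow> bool" where
  "unit_density F f \<longleftrightarrow> f \<in> borel_measurable borel \<and> (\<forall>w. 0 \<le> f w \<and> f w \<le> 1) \<and>
     (\<forall>t\<in>{0..1}. F t = integral {0..t} f)"

lemma bounded_borel_integrable_on:
  fixes f :: "real \<Rightarrow> real"
  assumes [measurable]: "f \<in> borel_measurable borel" and f: "\<And>w. \<bar>f w\<bar> \<le> B"
  shows "f integrable_on {a..b}"
proof -
  have "set_integrable lborel {a..b} f"
    unfolding set_integrable_def
  proof (rule Bochner_Integration.integrable_bound)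
    show "integrable lborel (\<lambda>w. B * indicator {a..b} w)"
      by (intro integrable_mult_right integrable_real_indicator)
        (auto simp: emeasure_lborel_Icc_eq)
    show "AE w in lborel. norm (indicator {a..b} w *\<^sub>R f w) \<le> norm (B * indicator {a..b} w)"
      using order_trans[OF f abs_ge_self] by (auto simp: indicator_def)
  qed measurable
  thus ?thesis by (rule set_borel_integral_eq_integral)
qed

lemma unit_density_integrable:
  "unit_density F f \<Longrightarrow> f integrable_on {a..b}"
  unfolding unit_density_def by (intro bounded_borel_integrable_on[where B = 1]) auto

lemma AE_open_imp_closed_unit_interval:
  assumes "AE w in lborel. w \<in> {0<..<1::real} \<longrightarrow> P w"
  shows "AE w\<in>{0..1} in lborel. P w"
  using assms AE_lborel_singleton[of "0::real"] AE_lborel_singleton[of "1::real"]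
  by eventually_elim auto

lemma unit_density_has_derivative:
  assumes "unit_density F f"
  shows "AE w\<in>{0..1} in lborel. (F has_real_derivative f w) (at w)"
proof (rule AE_open_imp_closed_unit_interval)
  show "AE w in lborel. w \<in> {0<..<1} \<longrightarrow> (F has_real_derivative f w) (at w)"
    using lebesgue_differentiation_indefinite_integral[OF unit_density_integrable[OF assms], of 0 1]
  proof (rule eventually_mono, intro impI)
    fix w :: real
    assume w: "w \<in> {0<..<1}"
      "w \<in> {0<..<1} \<longrightarrow> ((\<lambda>t. integral {0..t} f) has_real_derivative f w) (at w)"
    show "(F has_real_derivative f w) (at w)"
      by (rule has_field_derivative_transform_within_open[of "\<lambda>t. integral {0..t} f" _ _ "{0<..<1}"])
        (use w assms in \<open>auto simp: unit_density_def\<close>)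
  qed
qed

text \<open>
  The increments of \<open>G - F\<close> are nonnegative, hence so is its derivative wherever it exists, and that
  derivative is \<open>g - f\<close> almost everywhere.
\<close>

lemma unit_density_mono:
  assumes f: "unit_density F f" and g: "unit_density G g"
    and mono: "\<And>s t. 0 \<le> s \<Longrightarrow> s \<le> t \<Longrightarrow> t \<le> 1 \<Longrightarrow> F t - F s \<le> G t - G s"
  shows "AE w\<in>{0..1} in lborel. f w \<le> g w"
proof (rule AE_open_imp_closed_unit_interval)
  show "AE w in lborel. w \<in> {0<..<1} \<longrightarrow> f w \<le> g w"
    using unit_density_has_derivative[OF f] unit_density_has_derivative[OF g]
  proof eventually_elim
    case (elim w)
    show ?case
    proof
      assume w: "w \<in> {0<..<1}"
      hence "((\<lambda>t. G t - F t) has_real_derivative g w - f w) (at w)"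
        using elim by (intro derivative_intros) auto
      moreover have "mono_on {0<..<1} (\<lambda>t. G t - F t)"
        by (rule mono_onI) (use mono in \<open>force simp: algebra_simps\<close>)
      ultimately have "g w - f w \<ge> 0"
        by (intro mono_on_imp_deriv_nonneg[of "{0<..<1}"]) (use w in auto)
      thus "f w \<le> g w" by simp
    qed
  qed
qed

text \<open>
  Since \<open>f \<le> g\<close> almost everywhere, the absolute value can be dropped, which leaves a difference of
  total masses.
\<close>

lemma unit_density_L1_distance:
  assumes f: "unit_density F f" and g: "unit_density G g"
    and mono: "\<And>s t. 0 \<le> s \<Longrightarrow> s \<le> t \<Longrightarrow> t \<le> 1 \<Longrightarrow> F t - F s \<le> G t - G s"
  shows "integral {0..1} (\<lambda>w. \<bar>g w - f w\<bar>) = G 1 - F 1"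
proof -
  have "AE w in lborel. w \<in> {0..1} \<longrightarrow> \<bar>g w - f w\<bar> = g w - f w"
    using unit_density_mono[OF f g mono, simplified]
    by eventually_elim auto
  hence "integral {0..1} (\<lambda>w. \<bar>g w - f w\<bar>) = integral {0..1} (\<lambda>w. g w - f w)"
    unfolding integral_def integrable_on_def by (simp add: has_integral_AE)
  also have "\<dots> = integral {0..1} g - integral {0..1} f"
    by (intro Henstock_Kurzweil_Integration.integral_diff unit_density_integrable[OF f]
        unit_density_integrable[OF g])
  also have "\<dots> = G 1 - F 1" using f g by (simp add: unit_density_def)
  finally show ?thesis .
qed

lemma unit_density_prod:
  assumes "\<And>i. i \<in> I \<Longrightarrow> unit_density (G i) (g i)"
  shows "(\<lambda>w. \<Prod>i\<in>I. g i w) \<in> borel_measurable borel" "0 \<le> (\<Prod>i\<in>I. g i w)" "(\<Prod>i\<in>I. g i w) \<le> 1"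
  using assms unfolding unit_density_def
  by (auto intro!: borel_measurable_prod prod_nonneg prod_le_1)

text \<open>Two densities of the same \<open>F\<close> agree almost everywhere because both are its derivative.\<close>

lemma unit_density_cong_AE:
  assumes f: "unit_density F f" and g: "g \<in> borel_measurable borel" "\<And>w. 0 \<le> g w" "\<And>w. g w \<le> 1"
  shows "unit_density F g \<longleftrightarrow> (AE w\<in>{0..1} in lborel. f w = g w)"
proof
  assume "unit_density F g"
  from unit_density_has_derivative[OF f] unit_density_has_derivative[OF this]
  show "AE w\<in>{0..1} in lborel. f w = g w"
    by eventually_elim (auto intro: DERIV_unique)
next
  assume eq: "AE w\<in>{0..1} in lborel. f w = g w"
  have "integral {0..t} f = integral {0..t} g" if "t \<in> {0..1}" for t
  proof -
    have "AE w in lborel. w \<in> {0..t} \<longrightarrow> f w = g w"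
      using eq by eventually_elim (use that in auto)
    thus ?thesis unfolding integral_def integrable_on_def by (simp add: has_integral_AE)
  qed
  thus "unit_density F g" using f g by (auto simp: unit_density_def)
qed

text \<open>
  This removes derivatives from the claim: almost everywhere all of them exist and
  equal the densities, so the derivative identity is an identity of densities, and in integrated
  form it no longer mentions null sets.
\<close>

lemma unit_density_prod_iff_deriv:
  assumes f: "unit_density F f" and "finite I" and g: "\<And>i. i \<in> I \<Longrightarrow> unit_density (G i) (g i)"
  shows "(AE w\<in>{0..1} in lborel. F differentiable (at w) \<and> (\<forall>i\<in>I. G i differentiable (at w)) \<and>
            deriv F w = (\<Prod>i\<in>I. deriv (G i) w))
     \<longleftrightarrow> unit_density F (\<lambda>w. \<Prod>i\<in>I. g i w)"
proof -
  have derivs: "AE w in lborel. \<forall>i\<in>I. w \<in> {0..1} \<longrightarrow> (G i has_real_derivative g i w) (at w)"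
    by (intro AE_finite_allI \<open>finite I\<close> unit_density_has_derivative g)
  have "(AE w\<in>{0..1} in lborel. F differentiable (at w) \<and> (\<forall>i\<in>I. G i differentiable (at w)) \<and>
            deriv F w = (\<Prod>i\<in>I. deriv (G i) w))
     \<longleftrightarrow> (AE w\<in>{0..1} in lborel. f w = (\<Prod>i\<in>I. g i w))"
  proof (rule eventually_subst)
    show "AE w in lborel. (w \<in> {0..1} \<longrightarrow> F differentiable (at w) \<and>
        (\<forall>i\<in>I. G i differentiable (at w)) \<and> deriv F w = (\<Prod>i\<in>I. deriv (G i) w))
       = (w \<in> {0..1} \<longrightarrow> f w = (\<Prod>i\<in>I. g i w))"
      using derivs unit_density_has_derivative[OF f]
    proof eventually_elim
      case (elim w)
      show ?case
      proof (cases "w \<in> {0..1}")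
        case True
        have F: "(F has_real_derivative f w) (at w)"
          and G: "\<And>i. i \<in> I \<Longrightarrow> (G i has_real_derivative g i w) (at w)"
          using elim True by auto
        have "(\<Prod>i\<in>I. deriv (G i) w) = (\<Prod>i\<in>I. g i w)"
          by (intro prod.cong refl DERIV_imp_deriv G)
        moreover have "F differentiable (at w)" "\<forall>i\<in>I. G i differentiable (at w)"
          using F G real_differentiable_def by blast+
        ultimately show ?thesis using DERIV_imp_deriv[OF F] by simp
      next
        case False
        thus ?thesis by blast
      qed
    qed
  qed
  also have "\<dots> \<longleftrightarrow> unit_density F (\<lambda>w. \<Prod>i\<in>I. g i w)"
    by (intro unit_density_cong_AE[OF f, symmetric] unit_density_prod[where G = G] g)
  finally show ?thesis .
qed

section \<open>Slices of a measure along a uniform coordinate\<close>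

abbreviation "uniform_unit \<equiv> uniform_measure lborel {0..1::real}"

lemma prob_space_uniform_unit: "prob_space uniform_unit"
  by (rule prob_space_uniform_measure) auto

lemma nn_integral_uniform_unit:
  assumes [measurable]: "f \<in> borel_measurable borel"
  shows "(\<integral>\<^sup>+w. f w \<partial>uniform_unit) = (\<integral>\<^sup>+w. f w * indicator {0..1} w \<partial>lborel)"
  by (subst nn_integral_uniform_measure) (auto simp: divide_ennreal_def)

lemma nn_integral_unit_density:
  assumes f: "unit_density F f" and t: "t \<in> {0..1}"
  shows "(\<integral>\<^sup>+w. ennreal (f w) * indicator {..t} w \<partial>uniform_unit) = ennreal (F t)"
proof -
  have [measurable]: "f \<in> borel_measurable borel" using f by (simp add: unit_density_def)
  have "(\<integral>\<^sup>+w. ennreal (f w) * indicator {..t} w \<partial>uniform_unit)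
      = (\<integral>\<^sup>+w. ennreal (f w) * indicator {0..t} w \<partial>lborel)"
    by (subst nn_integral_uniform_unit, measurable, intro nn_integral_cong)
      (use t in \<open>auto simp: indicator_def\<close>)
  also have "\<dots> = ennreal (F t)"
    by (rule nn_integral_has_integral_lebesgue')
      (use f t unit_density_integrable[OF f, of 0 t] in
        \<open>auto simp: unit_density_def has_integral_integrable_integral\<close>)
  finally show ?thesis .
qed

lemma emeasure_distr_density_indicator:
  assumes [measurable]: "Y \<in> borel_measurable M" "S \<in> sets M" "B \<in> sets borel"
  shows "emeasure (distr (density M (indicator S)) borel Y) B = emeasure M {y \<in> S. Y y \<in> B}"
proof -
  have eq: "S \<inter> (Y -` B \<inter> space M) = {y \<in> S. Y y \<in> B}"
    using sets.sets_into_space[of S M] by auto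
  have "emeasure (distr (density M (indicator S)) borel Y) B
      = emeasure (density M (indicator S)) (Y -` B \<inter> space M)"
    by (subst emeasure_distr) (auto simp: measurable_density_eq1)
  also have "\<dots> = emeasure M (S \<inter> (Y -` B \<inter> space M))"
    by (rule emeasure_restricted) measurable
  finally show ?thesis by (simp only: eq)
qed

text \<open>
  The law of \<open>Y\<close> restricted to \<open>S\<close> is dominated by the law of \<open>Y\<close>, which is uniform. So it has a
  Radon-Nikodym derivative, and this derivative is at most one.
\<close>

lemma unit_density_exists:
  assumes "prob_space \<mu>" and [measurable]: "Y \<in> borel_measurable \<mu>" "S \<in> sets \<mu>"
    and uniform: "distr \<mu> borel Y = uniform_unit"
  shows "\<exists>f. unit_density (\<lambda>t. measure \<mu> {y \<in> S. Y y \<le> t}) f"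
proof -
  interpret \<mu>: prob_space \<mu> by fact
  interpret U: prob_space uniform_unit by (rule prob_space_uniform_unit)
  define \<nu> where "\<nu> = distr (density \<mu> (indicator S)) borel Y"
  have \<nu>: "emeasure \<nu> B = emeasure \<mu> {y \<in> S. Y y \<in> B}" if "B \<in> sets borel" for B
    unfolding \<nu>_def by (rule emeasure_distr_density_indicator[OF assms(2,3) that])
  have le: "emeasure \<nu> B \<le> emeasure uniform_unit B" if [measurable]: "B \<in> sets borel" for B
  proof -
    have "emeasure \<mu> {y \<in> S. Y y \<in> B} \<le> emeasure \<mu> (Y -` B \<inter> space \<mu>)"
      using sets.sets_into_space[of S \<mu>] by (intro emeasure_mono) auto
    thus ?thesis unfolding \<nu>[OF that] uniform[symmetric] by (simp add: emeasure_distr)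
  qed
  have "absolutely_continuous uniform_unit \<nu>"
    unfolding absolutely_continuous_def
  proof
    fix B assume "B \<in> null_sets uniform_unit"
    hence "B \<in> sets borel" "emeasure uniform_unit B = 0" by (auto dest: null_setsD1 null_setsD2)
    with le[of B] show "B \<in> null_sets \<nu>" by (intro null_setsI) (auto simp: \<nu>_def)
  qed
  moreover have "sets \<nu> = sets uniform_unit" by (simp add: \<nu>_def)
  ultimately obtain h where h_meas: "h \<in> borel_measurable uniform_unit"
    and h: "density uniform_unit h = \<nu>"
    using U.Radon_Nikodym_finite_measure_infinite by blast
  from h_meas have [measurable]: "h \<in> borel_measurable borel" by simp
  have h_le_1: "AE w in uniform_unit. h w \<le> 1"
  proof -
    \<comment> \<open>Domination on the set where \<open>h\<close> exceeds one leaves no mass for the excess \<open>h - 1\<close>.\<close>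
    let ?B = "{w. 1 < h w}"
    have B: "?B \<in> sets borel" by measurable
    have "emeasure uniform_unit ?B + (\<integral>\<^sup>+w. (h w - 1) * indicator ?B w \<partial>uniform_unit)
        = (\<integral>\<^sup>+w. indicator ?B w + (h w - 1) * indicator ?B w \<partial>uniform_unit)"
      by (subst nn_integral_add) auto
    also have "\<dots> = (\<integral>\<^sup>+w. h w * indicator ?B w \<partial>uniform_unit)"
      by (intro nn_integral_cong) (auto simp: indicator_def less_imp_le)
    also have "\<dots> = emeasure \<nu> ?B"
      unfolding h[symmetric] by (subst emeasure_density) auto
    also have "\<dots> \<le> emeasure uniform_unit ?B + 0" using le[OF B] by simp
    finally have "(\<integral>\<^sup>+w. (h w - 1) * indicator ?B w \<partial>uniform_unit) = 0"
      using U.emeasure_finite[of ?B] by (simp only: ennreal_add_left_cancel_le) auto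
    hence "AE w in uniform_unit. (h w - 1) * indicator ?B w = 0"
      by (subst (asm) nn_integral_0_iff_AE) auto
    thus ?thesis by eventually_elim (auto simp: indicator_def diff_eq_0_iff_ennreal not_less split: if_splits)
  qed
  \<comment> \<open>Truncation makes the bound hold everywhere; it changes \<open>h\<close> on a null set only.\<close>
  define f where "f = (\<lambda>w. enn2real (min 1 (h w)))"
  have f_bounds: "0 \<le> f w" "f w \<le> 1" for w
    unfolding f_def by (auto intro!: enn2real_leI)
  have f: "unit_density (\<lambda>t. integral {0..t} f) f"
    unfolding unit_density_def using f_bounds by (auto simp: f_def)
  have "measure \<mu> {y \<in> S. Y y \<le> t} = integral {0..t} f" if t: "t \<in> {0..1}" for t
  proof -
    have "ennreal (measure \<mu> {y \<in> S. Y y \<le> t}) = emeasure \<nu> {..t}"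
      by (subst \<nu>) (auto simp: \<mu>.emeasure_eq_measure)
    also have "\<dots> = (\<integral>\<^sup>+w. h w * indicator {..t} w \<partial>uniform_unit)"
      unfolding h[symmetric] by (subst emeasure_density) auto
    also have "\<dots> = (\<integral>\<^sup>+w. ennreal (f w) * indicator {..t} w \<partial>uniform_unit)"
    proof (rule nn_integral_cong_AE)
      show "AE w in uniform_unit. h w * indicator {..t} w = ennreal (f w) * indicator {..t} w"
        using h_le_1
      proof eventually_elim
        case (elim w)
        hence "ennreal (f w) = h w"
          unfolding f_def by (simp add: min_absorb2 le_less_trans[of _ 1])
        thus ?case by simp
      qed
    qed
    also have "\<dots> = ennreal (integral {0..t} f)" by (rule nn_integral_unit_density[OF f t])
    finally show ?thesis
      using f_bounds by (subst (asm) ennreal_inj) (auto intro!: Henstock_Kurzweil_Integration.integral_nonneg unit_density_integrable[OF f])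
  qed
  thus ?thesis using f unfolding unit_density_def by (intro exI[of _ f]) auto
qed

section \<open>Regularity of copulas\<close>

definition copula_law :: "'i set \<Rightarrow> (('i \<Rightarrow> real) \<Rightarrow> real) \<Rightarrow> ('i \<Rightarrow> real) measure \<Rightarrow> bool" where
  "copula_law I C \<mu> \<longleftrightarrow> finite I \<and> prob_space \<mu> \<and> sets \<mu> = sets (PiM I (\<lambda>_. borel)) \<and>
     (\<forall>i\<in>I. distr \<mu> borel (\<lambda>y. y i) = uniform_unit) \<and>
     (\<forall>u. (\<forall>i\<in>I. u i \<in> {0..1}) \<longrightarrow> C u = measure \<mu> {y \<in> space \<mu>. \<forall>i\<in>I. y i \<le> u i})"

lemma copula_obtain_law: "copula I C \<Longrightarrow> \<exists>\<mu>. copula_law I C \<mu>"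
  unfolding copula_def copula_law_def by blast

lemma copula_lawD:
  assumes "copula_law I C \<mu>"
  shows "finite I" "prob_space \<mu>" "i \<in> I \<Longrightarrow> distr \<mu> borel (\<lambda>y. y i) = uniform_unit"
    "(\<And>i. i \<in> I \<Longrightarrow> u i \<in> {0..1}) \<Longrightarrow> C u = measure \<mu> {y \<in> space \<mu>. \<forall>i\<in>I. y i \<le> u i}"
  using assms unfolding copula_law_def by blast+

lemma copula_law_coordinate_measurable:
  assumes "copula_law I C \<mu>" "i \<in> I"
  shows "(\<lambda>y. y i) \<in> borel_measurable \<mu>"
proof -
  have "sets \<mu> = sets (PiM I (\<lambda>_. borel))" using assms(1) by (simp add: copula_law_def)
  from measurable_cong_sets[OF this refl] show ?thesis
    using measurable_component_singleton[OF assms(2), of "\<lambda>_. borel"] by auto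
qed

text \<open>
  The lower orthants at \<open>u\<close> and \<open>v\<close> differ by points lying in one of the strips between
  \<open>u i\<close> and \<open>v i\<close>, and a strip has the mass of its width because the margins are uniform.
\<close>

lemma copula_lipschitz:
  assumes "copula I C" and u: "\<And>i. i \<in> I \<Longrightarrow> u i \<in> {0..1}" and v: "\<And>i. i \<in> I \<Longrightarrow> v i \<in> {0..1}"
  shows "\<bar>C u - C v\<bar> \<le> (\<Sum>i\<in>I. \<bar>u i - v i\<bar>)"
proof -
  obtain \<mu> where law: "copula_law I C \<mu>" using copula_obtain_law[OF assms(1)] ..
  note \<mu> = copula_lawD(2,1,3,4)[OF law]
    and meas[measurable] = copula_law_coordinate_measurable[OF law]
  interpret prob_space \<mu> by fact
  have [measurable]: "{y \<in> space \<mu>. \<forall>i\<in>I. y i \<le> u i} \<in> sets \<mu>" for u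
    using \<mu>(2) by measurable
  have strip: "measure \<mu> {y \<in> space \<mu>. a < y i \<and> y i \<le> b} \<le> \<bar>b - a\<bar>"
    if i: "i \<in> I" and "a \<in> {0..1}" "b \<in> {0..1}" for i a b
  proof -
    have [measurable]: "(\<lambda>y. y i) \<in> borel_measurable \<mu>" by (rule meas[OF i])
    have "{y \<in> space \<mu>. a < y i \<and> y i \<le> b} = (\<lambda>y. y i) -` {a<..b} \<inter> space \<mu>" by auto
    hence "measure \<mu> {y \<in> space \<mu>. a < y i \<and> y i \<le> b} = measure uniform_unit {a<..b}"
      unfolding \<mu>(3)[OF i, symmetric] by (subst measure_distr) auto
    also have "\<dots> = measure lborel ({0..1} \<inter> {a<..b})"
      by (subst measure_uniform_measure) auto
    also have "{0..1} \<inter> {a<..b} = {a<..b}" using that by auto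
    also have "measure lborel {a<..b} \<le> \<bar>b - a\<bar>" by (cases "a \<le> b") auto
    finally show ?thesis .
  qed
  have one_sided: "C u - C v \<le> (\<Sum>i\<in>I. \<bar>u i - v i\<bar>)"
    if u: "\<And>i. i \<in> I \<Longrightarrow> u i \<in> {0..1}" and v: "\<And>i. i \<in> I \<Longrightarrow> v i \<in> {0..1}" for u v
  proof -
    let ?L = "\<lambda>u. {y \<in> space \<mu>. \<forall>i\<in>I. y i \<le> u i}"
    let ?R = "\<lambda>i. {y \<in> space \<mu>. v i < y i \<and> y i \<le> u i}"
    have R: "?R i \<in> sets \<mu>" if "i \<in> I" for i using meas[OF that] by measurable
    have "C u = measure \<mu> (?L u)" by (rule \<mu>(4)[OF u])
    also have "\<dots> \<le> measure \<mu> (?L v \<union> (\<Union>i\<in>I. ?R i))"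
    proof (rule finite_measure_mono)
      show "?L u \<subseteq> ?L v \<union> (\<Union>i\<in>I. ?R i)" by (auto simp: not_le)
      show "?L v \<union> (\<Union>i\<in>I. ?R i) \<in> sets \<mu>"
        using R \<mu>(2) by (intro sets.Un sets.finite_UN) auto
    qed
    also have "\<dots> \<le> measure \<mu> (?L v) + measure \<mu> (\<Union>i\<in>I. ?R i)"
      using \<mu>(2) R by (intro measure_Un_le sets.finite_UN) auto
    also have "measure \<mu> (\<Union>i\<in>I. ?R i) \<le> (\<Sum>i\<in>I. measure \<mu> (?R i))"
      using \<mu>(2) R by (intro measure_UNION_le) auto
    also have "\<dots> \<le> (\<Sum>i\<in>I. \<bar>u i - v i\<bar>)"
      by (intro sum_mono strip u v)
    also have "measure \<mu> (?L v) = C v" by (rule \<mu>(4)[OF v, symmetric])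
    finally show ?thesis by simp
  qed
  show ?thesis using one_sided[OF u v] one_sided[OF v u] by (simp add: abs_minus_commute abs_le_iff)
qed

lemma copula_law_slice:
  assumes law: "copula_law I C \<mu>" and "k \<in> I"
  shows "{y \<in> space \<mu>. \<forall>i\<in>I-{k}. y i \<le> u i} \<in> sets \<mu>"
    and "\<lbrakk>\<And>i. i \<in> I - {k} \<Longrightarrow> u i \<in> {0..1}; t \<in> {0..1}\<rbrakk> \<Longrightarrow>
       C (u(k := t)) = measure \<mu> {y \<in> {y \<in> space \<mu>. \<forall>i\<in>I-{k}. y i \<le> u i}. y k \<le> t}"
proof -
  show "{y \<in> space \<mu>. \<forall>i\<in>I-{k}. y i \<le> u i} \<in> sets \<mu>"
  proof (rule sets.sets_Collect_finite_All)
    show "{y \<in> space \<mu>. y i \<le> u i} \<in> sets \<mu>" if "i \<in> I - {k}" for i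
      using that copula_law_coordinate_measurable[OF law, of i] by simp
  qed (use copula_lawD(1)[OF law] in simp)
next
  assume u: "\<And>i. i \<in> I - {k} \<Longrightarrow> u i \<in> {0..1}" and t: "t \<in> {0..1}"
  have "{y \<in> space \<mu>. \<forall>i\<in>I. y i \<le> (u(k := t)) i}
      = {y \<in> {y \<in> space \<mu>. \<forall>i\<in>I-{k}. y i \<le> u i}. y k \<le> t}"
    using assms(2) by auto
  thus "C (u(k := t)) = measure \<mu> {y \<in> {y \<in> space \<mu>. \<forall>i\<in>I-{k}. y i \<le> u i}. y k \<le> t}"
    using u t by (subst copula_lawD(4)[OF law]) auto
qed

lemma copula_slice_density_exists:
  assumes "copula I C" "k \<in> I" and u: "\<And>i. i \<in> I - {k} \<Longrightarrow> u i \<in> {0..1}"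
  shows "\<exists>c. unit_density (\<lambda>t. C (u(k := t))) c"
proof -
  obtain \<mu> where law: "copula_law I C \<mu>" using copula_obtain_law[OF assms(1)] ..
  note \<mu> = copula_lawD(2)[OF law] copula_lawD(3)[OF law assms(2)]
    copula_law_coordinate_measurable[OF law assms(2)] copula_law_slice[OF law assms(2)]
  from unit_density_exists[OF \<mu>(1,3,4,2), of u] obtain c where
    "unit_density (\<lambda>t. measure \<mu> {y \<in> {y \<in> space \<mu>. \<forall>i\<in>I-{k}. y i \<le> u i}. y k \<le> t}) c" by blast
  hence "unit_density (\<lambda>t. C (u(k := t))) c"
    unfolding unit_density_def using \<mu>(5)[of u, OF u] by auto
  thus ?thesis by blast
qed

text \<open>
  An increment in the coordinate \<open>k\<close> is the mass of the part of a lower orthant in a strip, and the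
  orthant grows with \<open>u\<close>. This is the monotonicity in \<open>u\<close> of the densities of the slices.
\<close>

lemma copula_increment_mono:
  assumes "copula I C" "k \<in> I"
    and u: "\<And>i. i \<in> I - {k} \<Longrightarrow> u i \<in> {0..1}" and v: "\<And>i. i \<in> I - {k} \<Longrightarrow> v i \<in> {0..1}"
    and uv: "\<And>i. i \<in> I - {k} \<Longrightarrow> u i \<le> v i" and st: "0 \<le> s" "s \<le> t" "t \<le> 1"
  shows "C (u(k := t)) - C (u(k := s)) \<le> C (v(k := t)) - C (v(k := s))"
proof -
  obtain \<mu> where law: "copula_law I C \<mu>" using copula_obtain_law[OF assms(1)] ..
  note \<mu> = copula_lawD(2)[OF law]
    and [measurable] = copula_law_coordinate_measurable[OF law assms(2)]
      copula_law_slice(1)[OF law assms(2)]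
    and C = copula_law_slice(2)[OF law assms(2)]
  interpret prob_space \<mu> by fact
  let ?S = "\<lambda>u. {y \<in> space \<mu>. \<forall>i\<in>I-{k}. y i \<le> u i}"
  have increment: "C (u(k := t)) - C (u(k := s)) = measure \<mu> {y \<in> ?S u. s < y k \<and> y k \<le> t}"
    if u: "\<And>i. i \<in> I - {k} \<Longrightarrow> u i \<in> {0..1}" for u
  proof -
    have m: "{y \<in> ?S u. y k \<le> r} \<in> sets \<mu>" for r
    proof -
      have "{y \<in> ?S u. y k \<le> r} = ?S u \<inter> {y \<in> space \<mu>. y k \<le> r}" by auto
      thus ?thesis by simp
    qed
    have "measure \<mu> ({y \<in> ?S u. y k \<le> t} - {y \<in> ?S u. y k \<le> s})
        = measure \<mu> {y \<in> ?S u. y k \<le> t} - measure \<mu> {y \<in> ?S u. y k \<le> s}"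
      by (rule finite_measure_Diff[OF m m]) (use st in auto)
    moreover have "{y \<in> ?S u. y k \<le> t} - {y \<in> ?S u. y k \<le> s} = {y \<in> ?S u. s < y k \<and> y k \<le> t}"
      by auto
    ultimately show ?thesis using C[of u t] C[of u s] u st by simp
  qed
  have m: "{y \<in> ?S v. s < y k \<and> y k \<le> t} \<in> sets \<mu>"
  proof -
    have "{y \<in> ?S v. s < y k \<and> y k \<le> t} = ?S v \<inter> {y \<in> space \<mu>. s < y k \<and> y k \<le> t}" by auto
    thus ?thesis by simp
  qed
  have "measure \<mu> {y \<in> ?S u. s < y k \<and> y k \<le> t} \<le> measure \<mu> {y \<in> ?S v. s < y k \<and> y k \<le> t}"
    by (rule finite_measure_mono[OF _ m]) (use uv order_trans in blast)
  thus ?thesis using increment[OF u] increment[OF v] by simp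
qed

text \<open>The densities increase with \<open>a\<close>, and the total mass of the slice at \<open>a\<close> is \<open>1\<close>-Lipschitz in \<open>a\<close>.\<close>

lemma bivariate_copula_density_L1:
  assumes cop: "copula {1, 2::nat} (\<lambda>v. E (v 1) (v 2))"
    and e: "unit_density (E a) e" "unit_density (E a') e'" and a: "a \<in> {0..1}" "a' \<in> {0..1}"
  shows "integral {0..1} (\<lambda>w. \<bar>e w - e' w\<bar>) \<le> \<bar>a - a'\<bar>"
proof -
  have ordered: "integral {0..1} (\<lambda>w. \<bar>e' w - e w\<bar>) \<le> \<bar>a' - a\<bar>"
    if e: "unit_density (E a) e" "unit_density (E a') e'" and a: "a \<in> {0..1}" "a' \<in> {0..1}"
      and "a \<le> a'" for a a' e e'
  proof -
    have "E a t - E a s \<le> E a' t - E a' s" if "0 \<le> s" "s \<le> t" "t \<le> 1" for s t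
      using copula_increment_mono[OF cop, of 2 "\<lambda>_. a" "\<lambda>_. a'" s t] that a \<open>a \<le> a'\<close> by simp
    from unit_density_L1_distance[OF e this]
    have eq: "integral {0..1} (\<lambda>w. \<bar>e' w - e w\<bar>) = E a' 1 - E a 1" by blast
    have "\<bar>E a' 1 - E a 1\<bar> \<le> \<bar>a' - a\<bar>"
    proof -
      let ?v = "\<lambda>a. (\<lambda>_. 1)(1::nat := a)"
      have "\<bar>E (?v a' 1) (?v a' 2) - E (?v a 1) (?v a 2)\<bar> \<le> (\<Sum>i\<in>{1,2}. \<bar>?v a' i - ?v a i\<bar>)"
        by (rule copula_lipschitz[OF cop]) (use a in auto)
      thus ?thesis by simp
    qed
    with eq show ?thesis by simp
  qed
  show ?thesis
    using ordered[of a e a' e'] ordered[of a' e' a e] e a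
    by (cases "a \<le> a'") (simp_all add: abs_minus_commute)
qed

text \<open>
  Clamping the coordinates of \<open>u\<close> to \<open>[\<delta>, 1 - \<delta>]\<close> gives an interior point. Both
  sides of the integrated factorization change by at most \<open>card I * \<delta>\<close>: the left one by the
  Lipschitz property, the right one because a product of numbers in \<open>[0,1]\<close> changes by at most the
  sum of the changes of its factors. Then \<open>\<delta>\<close> tends to zero.
\<close>

lemma slice_factorization_closed_cube:
  assumes cop: "copula (insert k I) C" and k: "k \<notin> I"
    and cops: "\<And>i. i \<in> I \<Longrightarrow> copula {1, 2::nat} (\<lambda>v. D i (v 1) (v 2))"
    and d: "\<And>i a. i \<in> I \<Longrightarrow> a \<in> {0..1} \<Longrightarrow> unit_density (D i a) (d i a)"
    and interior: "\<And>u. (\<And>i. i \<in> I \<Longrightarrow> u i \<in> {0<..<1}) \<Longrightarrow>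
          unit_density (\<lambda>t. C (u(k := t))) (\<lambda>w. \<Prod>i\<in>I. d i (u i) w)"
    and u: "\<And>i. i \<in> I \<Longrightarrow> u i \<in> {0..1}"
  shows "unit_density (\<lambda>t. C (u(k := t))) (\<lambda>w. \<Prod>i\<in>I. d i (u i) w)"
proof -
  have "finite I" using cop by (simp add: copula_def)
  let ?p = "\<lambda>u w. \<Prod>i\<in>I. d i (u i) w"
  have bounds: "0 \<le> d i (u i) w" "d i (u i) w \<le> 1" if "i \<in> I" "u i \<in> {0..1}" for i u w
    using d[OF that] by (auto simp: unit_density_def)
  have p: "?p u \<in> borel_measurable borel" "0 \<le> ?p u w" "?p u w \<le> 1"
    if "\<And>i. i \<in> I \<Longrightarrow> u i \<in> {0..1}" for u w
    using unit_density_prod[where G = "\<lambda>i. D i (u i)" and g = "\<lambda>i. d i (u i)" and I = I] d that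
    by blast+
  have p_int: "?p u integrable_on {a..b}" if "\<And>i. i \<in> I \<Longrightarrow> u i \<in> {0..1}" for u a b
    by (rule bounded_borel_integrable_on[where B = 1]) (use p[of u] that in auto)
  have "C (u(k := t)) = integral {0..t} (?p u)" if t: "t \<in> {0..1}" for t
  proof -
    have approx: "\<bar>C (u(k := t)) - integral {0..t} (?p u)\<bar> \<le> 2 * real (card I) * \<delta>"
      if \<delta>: "\<delta> \<in> {0<..<1/2}" for \<delta> :: real
    proof -
      define v where "v i = max \<delta> (min (1 - \<delta>) (u i))" for i
      have v: "v i \<in> {0<..<1}" for i using \<delta> by (auto simp: v_def)
      have v': "v i \<in> {0..1}" for i using v[of i] by simp
      have uv: "\<bar>u i - v i\<bar> \<le> \<delta>" if "i \<in> I" for i using u[OF that] \<delta> by (auto simp: v_def)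
      have diff_int: "(\<lambda>w. \<bar>d i (v i) w - d i (u i) w\<bar>) integrable_on {a..b}" if "i \<in> I" for i a b
      proof (rule bounded_borel_integrable_on[where B = 1])
        show "(\<lambda>w. \<bar>d i (v i) w - d i (u i) w\<bar>) \<in> borel_measurable borel"
        proof -
          have [measurable]: "d i (v i) \<in> borel_measurable borel" "d i (u i) \<in> borel_measurable borel"
            using d[OF that v'[of i]] d[OF that u[OF that]] by (simp_all add: unit_density_def)
          show ?thesis by measurable
        qed
        show "\<bar>\<bar>d i (v i) w - d i (u i) w\<bar>\<bar> \<le> 1" for w
          using bounds[of i v w] bounds[of i u w] that u[OF that] v'[of i] by auto
      qed
      have "\<bar>C (u(k := t)) - C (v(k := t))\<bar>
          \<le> (\<Sum>i\<in>insert k I. \<bar>(u(k := t)) i - (v(k := t)) i\<bar>)"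
        by (rule copula_lipschitz[OF cop]) (use u v' t in auto)
      also have "\<dots> = (\<Sum>i\<in>I. \<bar>u i - v i\<bar>)"
        using \<open>finite I\<close> k by (subst sum.insert) (auto intro!: sum.cong)
      also have "\<dots> \<le> card I * \<delta>" using sum_bounded_above[of I, OF uv] by simp
      finally have 1: "\<bar>C (u(k := t)) - C (v(k := t))\<bar> \<le> card I * \<delta>" .
      have "\<bar>integral {0..t} (?p v) - integral {0..t} (?p u)\<bar>
          = norm (integral {0..t} (\<lambda>w. ?p v w - ?p u w))"
        using p_int[of u 0 t] p_int[of v 0 t] u v'
        by (subst Henstock_Kurzweil_Integration.integral_diff) auto
      also have "\<dots> \<le> integral {0..t} (\<lambda>w. \<Sum>i\<in>I. \<bar>d i (v i) w - d i (u i) w\<bar>)"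
      proof (rule integral_norm_bound_integral)
        show "(\<lambda>w. ?p v w - ?p u w) integrable_on {0..t}"
          by (intro integrable_diff p_int v' u)
        show "(\<lambda>w. \<Sum>i\<in>I. \<bar>d i (v i) w - d i (u i) w\<bar>) integrable_on {0..t}"
          by (intro integrable_sum \<open>finite I\<close> diff_int)
        show "norm (?p v w - ?p u w) \<le> (\<Sum>i\<in>I. \<bar>d i (v i) w - d i (u i) w\<bar>)" for w
          using norm_prod_diff[of I "\<lambda>i. d i (v i) w" "\<lambda>i. d i (u i) w"] bounds u v' by simp
      qed
      also have "\<dots> = (\<Sum>i\<in>I. integral {0..t} (\<lambda>w. \<bar>d i (v i) w - d i (u i) w\<bar>))"
        by (intro integral_sum \<open>finite I\<close> diff_int)
      also have "\<dots> \<le> (\<Sum>i\<in>I. \<delta>)"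
      proof (rule sum_mono)
        fix i assume i: "i \<in> I"
        have "integral {0..t} (\<lambda>w. \<bar>d i (v i) w - d i (u i) w\<bar>)
            \<le> integral {0..1} (\<lambda>w. \<bar>d i (v i) w - d i (u i) w\<bar>)"
          by (rule integral_subset_le) (use t diff_int[OF i] in auto)
        also have "\<dots> \<le> \<bar>v i - u i\<bar>"
          by (rule bivariate_copula_density_L1[OF cops d d]) (use i u v' in auto)
        also have "\<dots> \<le> \<delta>" using uv[OF i] by (simp add: abs_minus_commute)
        finally show "integral {0..t} (\<lambda>w. \<bar>d i (v i) w - d i (u i) w\<bar>) \<le> \<delta>" .
      qed
      finally have 2: "\<bar>integral {0..t} (?p v) - integral {0..t} (?p u)\<bar> \<le> card I * \<delta>" by simp
      have "C (v(k := t)) = integral {0..t} (?p v)"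
        using interior[of v] v t by (simp add: unit_density_def)
      with 1 2 show ?thesis by linarith
    qed
    have "\<bar>C (u(k := t)) - integral {0..t} (?p u)\<bar> \<le> 0"
    proof (rule tendsto_lowerbound)
      show "((\<lambda>\<delta>. 2 * real (card I) * \<delta>) \<longlongrightarrow> 0) (at_right (0::real))"
        by (auto intro!: tendsto_eq_intros)
      show "\<forall>\<^sub>F \<delta> in at_right (0::real). \<bar>C (u(k := t)) - integral {0..t} (?p u)\<bar> \<le> 2 * real (card I) * \<delta>"
        unfolding eventually_at_right_field using approx by (intro exI[of _ "1/2"]) auto
    qed simp
    thus ?thesis by simp
  qed
  with p[of u] u show ?thesis by (simp add: unit_density_def)
qed

section \<open>Conditional probabilities and the probability integral transform\<close>

lemma (in real_distribution) borel_measurable_cdf: "cdf M \<in> borel_measurable borel"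
  by (intro borel_measurable_mono monoI cdf_nondecreasing)

text \<open>
  For \<open>0 \<le> t < 1\<close> the set where the distribution function is at most \<open>t\<close> is, if nonempty, a closed
  ray \<open>{..z}\<close> by continuity, and the value at \<open>z\<close> is exactly \<open>t\<close>. It can be empty only for
  \<open>t = 0\<close>.
\<close>

lemma (in real_distribution) distr_cdf_uniform:
  assumes cont: "\<And>x. isCont (cdf M) x"
  shows "distr M borel (cdf M) = uniform_unit"
proof (rule cdf_unique)
  interpret U: prob_space uniform_unit by (rule prob_space_uniform_unit)
  note borel_measurable_cdf[measurable]
  show "real_distribution (distr M borel (cdf M))"
    by (rule real_distribution_distr) simp
  show "real_distribution uniform_unit"
    by (intro real_distribution.intro prob_space_uniform_unit real_distribution_axioms.intro) simp
  have lhs: "cdf (distr M borel (cdf M)) t = measure M {x. cdf M x \<le> t}" for t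
    unfolding cdf_def[of "distr M borel (cdf M)"]
    by (subst measure_distr) (auto simp: vimage_def)
  have sub: "measure M {x. cdf M x \<le> t} = t" if t: "0 \<le> t" "t < 1" for t
  proof (cases "{x. cdf M x \<le> t} = {}")
    case True
    have "t \<le> 0"
    proof (rule tendsto_lowerbound[OF cdf_lim_at_bot])
      show "\<forall>\<^sub>F x in at_bot. t \<le> cdf M x" using True by (intro always_eventually) (auto simp: not_le less_imp_le)
    qed simp
    with True t show ?thesis by simp
  next
    case False
    define z where "z = Sup {x. cdf M x \<le> t}"
    have "\<forall>\<^sub>F x in at_top. t < cdf M x"
      using order_tendstoD(1)[OF cdf_lim_at_top_prob t(2)] .
    then obtain b where b: "\<And>x. b \<le> x \<Longrightarrow> t < cdf M x" by (auto simp: eventually_at_top_linorder)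
    have bdd: "bdd_above {x. cdf M x \<le> t}"
    proof (rule bdd_aboveI)
      show "x \<le> b" if "x \<in> {x. cdf M x \<le> t}" for x using b[of x] that by (cases "b \<le> x") auto
    qed
    have "closed {x. cdf M x \<le> t}"
      using cont by (intro closed_Collect_le) (auto intro!: continuous_at_imp_continuous_on)
    hence z: "cdf M z \<le> t" using closed_contains_Sup[OF False bdd] by (simp add: z_def)
    have above: "t < cdf M x" if "z < x" for x
      using cSup_upper[OF _ bdd, of x] that unfolding z_def by (auto simp: not_less[symmetric])
    have "t \<le> cdf M z"
    proof (rule tendsto_lowerbound)
      show "(cdf M \<longlongrightarrow> cdf M z) (at_right z)" using cdf_is_right_cont[of z] by (simp add: continuous_within)
      show "\<forall>\<^sub>F x in at_right z. t \<le> cdf M x"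
        unfolding eventually_at_right_field using above by (intro exI[of _ "z + 1"]) (auto intro: less_imp_le)
    qed simp
    with z have "cdf M z = t" by simp
    moreover have "{x. cdf M x \<le> t} = {..z}"
    proof safe
      show "x \<le> z" if "cdf M x \<le> t" for x using above[of x] that by (meson not_less)
      show "cdf M x \<le> t" if "x \<le> z" for x using cdf_nondecreasing[OF that] z by linarith
    qed
    ultimately show ?thesis by (simp add: cdf_def)
  qed
  show "cdf (distr M borel (cdf M)) = cdf uniform_unit"
  proof
    fix t :: real
    have rhs: "cdf uniform_unit t = measure lborel ({0..1} \<inter> {..t})"
      unfolding cdf_def by (subst measure_uniform_measure) auto
    consider "t < 0" | "0 \<le> t" "t < 1" | "1 \<le> t" by linarith
    thus "cdf (distr M borel (cdf M)) t = cdf uniform_unit t"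
    proof cases
      case 1
      hence "{x. cdf M x \<le> t} = {}" "{0..1} \<inter> {..t} = {}" using cdf_nonneg by (auto simp: not_le intro: less_le_trans)
      thus ?thesis unfolding lhs rhs by simp
    next
      case 2
      hence "{0..1} \<inter> {..t} = {0..t}" by auto
      thus ?thesis unfolding lhs rhs using sub 2 by simp
    next
      case 3
      hence "{x. cdf M x \<le> t} = UNIV" "{0..1} \<inter> {..t} = {0..1}" using cdf_bounded_prob by (auto intro: order_trans)
      thus ?thesis unfolding lhs rhs using prob_space by simp
    qed
  qed
qed

text \<open>
  Densities with respect to the law of \<open>Z\<close> are unique, so it suffices that \<open>z \<mapsto> f (F\<^sub>Z z)\<close>
  gives every ray \<open>{..z}\<close> the mass \<open>F (F\<^sub>Z z)\<close>, where \<open>F\<^sub>Z\<close> is the distribution function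
  of \<open>Z\<close>. This is the substitution \<open>w = F\<^sub>Z z\<close>, which carries the law of \<open>Z\<close> to the uniform law.
\<close>

lemma cond_prob_at_eq_density:
  assumes "prob_space M" and [measurable]: "Z \<in> borel_measurable M" "A \<in> sets M"
    and cont: "\<And>x. isCont (cdf (distr M borel Z)) x"
    and f: "unit_density F f"
    and F: "\<And>z. measure M {\<omega> \<in> A. Z \<omega> \<le> z} = F (cdf (distr M borel Z) z)"
  shows "AE z in distr M borel Z. cond_prob_at M Z A z = f (cdf (distr M borel Z) z)"
proof -
  interpret M: prob_space M by fact
  define P where "P = distr M borel Z"
  interpret P: real_distribution P unfolding P_def by (rule M.real_distribution_distr) simp
  have uniform: "distr P borel (cdf P) = uniform_unit"
    by (rule P.distr_cdf_uniform) (use cont in \<open>simp add: P_def\<close>)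
  note P.borel_measurable_cdf[measurable]
  have [measurable]: "f \<in> borel_measurable borel" and f0: "\<And>w. 0 \<le> f w"
    using f by (auto simp: unit_density_def)
  define \<nu> where "\<nu> = distr (density M (indicator A)) borel Z"
  have \<nu>: "emeasure \<nu> B = emeasure M {\<omega> \<in> A. Z \<omega> \<in> B}" if "B \<in> sets borel" for B
    unfolding \<nu>_def by (rule emeasure_distr_density_indicator[OF assms(2,3) that])
  have F01: "cdf P z \<in> {0..1}" for z using P.cdf_nonneg P.cdf_bounded_prob by auto
  let ?g = "\<lambda>z. ennreal (f (cdf P z))"
  \<comment> \<open>The distribution function may be constant on intervals, so \<open>F\<^sub>Z s \<le> F\<^sub>Z z\<close> does not imply
    \<open>s \<le> z\<close>; but both conditions have the same probability.\<close>
  have same_rays: "AE s in P. indicator {..z} s = (indicator {..cdf P z} (cdf P s) :: ennreal)" for z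
  proof -
    let ?D = "{s. cdf P s \<le> cdf P z} - {..z}"
    have "measure P {s. cdf P s \<le> cdf P z} = measure uniform_unit {..cdf P z}"
      unfolding uniform[symmetric] by (subst measure_distr) (auto simp: vimage_def)
    also have "\<dots> = measure lborel ({0..1} \<inter> {..cdf P z})"
      by (subst measure_uniform_measure) auto
    also have "{0..1} \<inter> {..cdf P z} = {0..cdf P z}" using F01[of z] by auto
    also have "measure lborel {0..cdf P z} = measure P {..z}" using F01[of z] by (simp add: cdf_def)
    finally have "measure P ?D = 0"
      by (subst P.finite_measure_Diff) (auto intro: P.cdf_nondecreasing)
    hence "AE s in P. s \<notin> ?D"
      by (intro AE_not_in) (auto simp: null_sets_def P.emeasure_eq_measure)
    thus ?thesis
      by eventually_elim (auto simp: indicator_def intro: P.cdf_nondecreasing)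
  qed
  have mass: "emeasure (density P ?g) {..z} = emeasure \<nu> {..z}" for z
  proof -
    have "emeasure (density P ?g) {..z} = (\<integral>\<^sup>+s. ?g s * indicator {..z} s \<partial>P)"
      by (subst emeasure_density) auto
    also have "\<dots> = (\<integral>\<^sup>+s. ?g s * indicator {..cdf P z} (cdf P s) \<partial>P)"
      by (rule nn_integral_cong_AE) (use same_rays[of z] in \<open>eventually_elim, simp\<close>)
    also have "\<dots> = (\<integral>\<^sup>+w. ennreal (f w) * indicator {..cdf P z} w \<partial>distr P borel (cdf P))"
      by (subst nn_integral_distr) auto
    also have "\<dots> = ennreal (F (cdf P z))"
      unfolding uniform by (rule nn_integral_unit_density[OF f F01])
    also have "\<dots> = emeasure \<nu> {..z}"
      by (subst \<nu>) (auto simp: F[folded P_def, symmetric] M.emeasure_eq_measure)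
    finally show ?thesis .
  qed
  have "density P ?g = \<nu>"
  proof (rule cdf_unique')
    have "emeasure \<nu> (space \<nu>) \<noteq> \<infinity>"
      using \<nu>[of UNIV] M.emeasure_finite by (simp add: \<nu>_def)
    thus "finite_borel_measure \<nu>"
      by (intro finite_borel_measure.intro finite_measureI finite_borel_measure_axioms.intro)
        (auto simp: \<nu>_def)
    have "emeasure (density P ?g) (space (density P ?g)) = (\<integral>\<^sup>+s. ?g s \<partial>P)"
      by (subst emeasure_density) (auto intro!: nn_integral_cong)
    also have "\<dots> \<le> (\<integral>\<^sup>+s. 1 \<partial>P)"
      by (rule nn_integral_mono) (use f in \<open>auto simp: unit_density_def\<close>)
    also have "\<dots> < \<infinity>" using P.emeasure_space_1 by simp
    finally show "finite_borel_measure (density P ?g)"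
      by (intro finite_borel_measure.intro finite_measureI finite_borel_measure_axioms.intro) auto
    show "cdf (density P ?g) = cdf \<nu>"
      by (rule ext) (simp only: cdf_def[of "density P _"] cdf_def[of \<nu>] measure_def mass)
  qed
  hence "AE z in P. ?g z = RN_deriv P \<nu> z" by (intro P.RN_deriv_unique) auto
  thus ?thesis
    unfolding cond_prob_at_def P_def[symmetric] \<nu>_def[symmetric]
    by eventually_elim (use f0 in \<open>metis enn2real_ennreal\<close>)
qed

lemma AE_cdf_transform:
  assumes "real_distribution P" and cont: "\<And>x. isCont (cdf P) x"
    and [measurable]: "f \<in> borel_measurable borel" "g \<in> borel_measurable borel"
  shows "(AE z in P. f (cdf P z) = g (cdf P z)) \<longleftrightarrow> (AE w\<in>{0..1} in lborel. f w = (g w :: real))"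
proof -
  interpret real_distribution P by fact
  note borel_measurable_cdf[measurable]
  have "(AE z in P. f (cdf P z) = g (cdf P z)) \<longleftrightarrow> (AE w in distr P borel (cdf P). f w = g w)"
    by (subst AE_distr_iff) auto
  also have "\<dots> \<longleftrightarrow> (AE w\<in>{0..1} in lborel. f w = g w)"
    unfolding distr_cdf_uniform[OF cont] by (subst AE_uniform_measure) auto
  finally show ?thesis .
qed

lemma (in prob_space) distributed_lborel_cdf:
  assumes "distributed M lborel Y h"
  shows "Y \<in> borel_measurable M" "isCont (cdf (distr M borel Y)) x"
proof -
  show meas[measurable]: "Y \<in> borel_measurable M" using distributed_measurable[OF assms] by simp
  interpret P: real_distribution "distr M borel Y" by (rule real_distribution_distr) simp
  have [measurable]: "h \<in> borel_measurable borel"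
    using distributed_borel_measurable[OF assms] by simp
  have "distr M borel Y = distr M lborel Y" by (rule distr_cong) auto
  hence law: "distr M borel Y = density lborel h" using distributed_distr_eq_density[OF assms] by simp
  have "emeasure (density lborel h) {x} = (\<integral>\<^sup>+s. h s * indicator {x} s \<partial>lborel)"
    by (subst emeasure_density) auto
  also have "\<dots> = 0"
    by (subst nn_integral_0_iff_AE, measurable) (use AE_lborel_singleton[of x] in \<open>eventually_elim, auto\<close>)
  finally have "measure (distr M borel Y) {x} = 0" unfolding law by (simp add: measure_def)
  thus "isCont (cdf (distr M borel Y)) x" unfolding P.isCont_cdf .
qed

lemma (in real_distribution) continuous_cdf_attains:
  assumes cont: "\<And>x. isCont (cdf M) x" and t: "0 < t" "t < 1"
  shows "\<exists>x. cdf M x = t"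
proof -
  have "\<forall>\<^sub>F x in at_bot. cdf M x < t" using order_tendstoD(2)[OF cdf_lim_at_bot t(1)] .
  then obtain a where a: "cdf M a < t" by (auto simp: eventually_at_bot_linorder)
  have "\<forall>\<^sub>F x in at_top. t < cdf M x" using order_tendstoD(1)[OF cdf_lim_at_top_prob t(2)] .
  then obtain b where b: "t < cdf M b" by (auto simp: eventually_at_top_linorder)
  have "a \<le> b" using cdf_nondecreasing[of b a] a b by linarith
  with IVT[of "cdf M" a t b] a b cont show ?thesis by auto
qed

section \<open>The characterization\<close>

theorem corollary1:
  fixes M :: "'a measure" and n :: nat
    and X :: "nat \<Rightarrow> 'a \<Rightarrow> real" and Z :: "'a \<Rightarrow> real"
    and C :: "(nat \<Rightarrow> real) \<Rightarrow> real" and D :: "nat \<Rightarrow> real \<Rightarrow> real \<Rightarrow> real"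
  assumes "prob_space M"
    and "n \<ge> 1"
    and "\<And>i. i \<in> {1..n} \<Longrightarrow> \<exists>f. distributed M lborel (X i) f"
    and "\<exists>f. distributed M lborel Z f"
    and "copula_of M {1..Suc n} (X(Suc n := Z)) C"
    and "\<And>i. i \<in> {1..n} \<Longrightarrow>
           copula_of M {1, 2::nat} (\<lambda>k. if k = 1 then X i else Z) (\<lambda>v. D i (v 1) (v 2))"
  shows "cond_indep_given M n X Z \<longleftrightarrow>
    (\<forall>u. (\<forall>i\<in>{1..n}. u i \<in> {0..1}) \<longrightarrow>
      (AE w\<in>{0..1} in lborel.
         (\<lambda>t. C (u(Suc n := t))) differentiable (at w) \<and>
         (\<forall>i\<in>{1..n}. (\<lambda>t. D i (u i) t) differentiable (at w)) \<and>
         deriv (\<lambda>t. C (u(Suc n := t))) w = (\<Prod>i=1..n. deriv (\<lambda>t. D i (u i) t) w)))"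
proof -
  interpret prob_space M by fact
  let ?cube = "\<lambda>u::nat \<Rightarrow> real. \<forall>i\<in>{1..n}. u i \<in> {0..1}"
  define P where "P = distr M borel Z"
  define G where "G i = cdf (distr M borel (X i))" for i
  have Z[measurable]: "Z \<in> borel_measurable M" and Z_cont: "isCont (cdf P) z" for z
    using assms(4) distributed_lborel_cdf unfolding P_def by blast+
  have X[measurable]: "X i \<in> borel_measurable M" and X_cont: "isCont (G i) x"
    if "i \<in> {1..n}" for i x
    using assms(3)[OF that] distributed_lborel_cdf unfolding G_def by blast+
  have X_dist: "real_distribution (distr M borel (X i))" if "i \<in> {1..n}" for i
    using X[OF that] by (rule real_distribution_distr)
  have G_cube: "G i x \<in> {0..1}" if i: "i \<in> {1..n}" for i x
  proof -
    interpret Xi: real_distribution "distr M borel (X i)" by (rule X_dist[OF i])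
    show ?thesis using Xi.cdf_nonneg Xi.cdf_bounded_prob by (simp add: G_def)
  qed
  have P: "real_distribution P" unfolding P_def by (rule real_distribution_distr[OF Z])
  have cop: "copula {1..Suc n} C"
    and C_eq: "measure M {\<omega> \<in> space M. \<forall>i\<in>{1..Suc n}. (X(Suc n := Z)) i \<omega> \<le> x i}
          = C (\<lambda>i. cdf (distr M borel ((X(Suc n := Z)) i)) (x i))" for x
    using assms(5) unfolding copula_of_def by blast+
  have copD: "copula {1, 2::nat} (\<lambda>v. D i (v 1) (v 2))" if "i \<in> {1..n}" for i
    using assms(6)[OF that] unfolding copula_of_def by blast
  have D_eq: "measure M {\<omega> \<in> space M. \<forall>k\<in>{1, 2::nat}. (if k = 1 then X i else Z) \<omega> \<le> x k}
      = D i (cdf (distr M borel (X i)) (x 1)) (cdf (distr M borel Z) (x 2))" if "i \<in> {1..n}" for i x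
    using assms(6)[OF that] unfolding copula_of_def by simp

  have "\<exists>c. unit_density (\<lambda>t. C (u(Suc n := t))) c" if "?cube u" for u
    by (rule copula_slice_density_exists[OF cop]) (use that in auto)
  then obtain c where c: "\<And>u. ?cube u \<Longrightarrow> unit_density (\<lambda>t. C (u(Suc n := t))) (c u)" by metis
  have "\<exists>d. unit_density (D i a) d" if "i \<in> {1..n}" "a \<in> {0..1}" for i a
    using copula_slice_density_exists[OF copD[OF that(1)], of 2 "\<lambda>_. a"] that(2) by simp
  then obtain d where d: "\<And>i a. i \<in> {1..n} \<Longrightarrow> a \<in> {0..1} \<Longrightarrow> unit_density (D i a) (d i a)" by metis

  let ?p = "\<lambda>u w. \<Prod>i=1..n. d i (u i) w"
  \<comment> \<open>The common reformulation of both sides at a point of the cube.\<close>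
  define factorizes where "factorizes u \<longleftrightarrow> unit_density (\<lambda>t. C (u(Suc n := t))) (?p u)" for u
  have p: "?p u \<in> borel_measurable borel" "0 \<le> ?p u w" "?p u w \<le> 1" if "?cube u" for u w
    using unit_density_prod[where G = "\<lambda>i. D i (u i)" and g = "\<lambda>i. d i (u i)" and I = "{1..n}"] d that
    by blast+

  have deriv_iff: "(AE w\<in>{0..1} in lborel.
         (\<lambda>t. C (u(Suc n := t))) differentiable (at w) \<and>
         (\<forall>i\<in>{1..n}. (\<lambda>t. D i (u i) t) differentiable (at w)) \<and>
         deriv (\<lambda>t. C (u(Suc n := t))) w = (\<Prod>i=1..n. deriv (\<lambda>t. D i (u i) t) w))
      \<longleftrightarrow> factorizes u" if "?cube u" for u
    unfolding factorizes_def
    by (rule unit_density_prod_iff_deriv[OF c[OF that]]) (use d that in auto)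

  have cond_iff: "(AE z in P.
        cond_prob_at M Z {\<omega> \<in> space M. \<forall>i\<in>{1..n}. X i \<omega> \<le> x i} z
        = (\<Prod>i=1..n. cond_prob_at M Z {\<omega> \<in> space M. X i \<omega> \<le> x i} z))
      \<longleftrightarrow> factorizes (\<lambda>i. G i (x i))" for x
  proof -
    define u where "u = (\<lambda>i. G i (x i))"
    have u: "?cube u" using G_cube by (simp add: u_def)
    have joint: "AE z in P. cond_prob_at M Z {\<omega> \<in> space M. \<forall>i\<in>{1..n}. X i \<omega> \<le> x i} z = c u (cdf P z)"
      unfolding P_def
    proof (rule cond_prob_at_eq_density[OF assms(1) Z _ Z_cont[unfolded P_def] c[OF u]])
      show "{\<omega> \<in> space M. \<forall>i\<in>{1..n}. X i \<omega> \<le> x i} \<in> sets M" by measurable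
      fix z
      have "{\<omega> \<in> {\<omega> \<in> space M. \<forall>i\<in>{1..n}. X i \<omega> \<le> x i}. Z \<omega> \<le> z}
          = {\<omega> \<in> space M. \<forall>i\<in>{1..Suc n}. (X(Suc n := Z)) i \<omega> \<le> (x(Suc n := z)) i}"
        by (auto simp: atLeastAtMostSuc_conv)
      moreover have "(\<lambda>i. cdf (distr M borel ((X(Suc n := Z)) i)) ((x(Suc n := z)) i))
          = u(Suc n := cdf (distr M borel Z) z)"
        by (auto simp: u_def G_def)
      ultimately show "measure M {\<omega> \<in> {\<omega> \<in> space M. \<forall>i\<in>{1..n}. X i \<omega> \<le> x i}. Z \<omega> \<le> z}
          = C (u(Suc n := cdf (distr M borel Z) z))"
        using C_eq[of "x(Suc n := z)"] by simp
    qed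
    have "AE z in P. cond_prob_at M Z {\<omega> \<in> space M. X i \<omega> \<le> x i} z = d i (u i) (cdf P z)"
      if i: "i \<in> {1..n}" for i
      unfolding P_def
    proof (rule cond_prob_at_eq_density[OF assms(1) Z _ Z_cont[unfolded P_def] d[OF i]])
      show "{\<omega> \<in> space M. X i \<omega> \<le> x i} \<in> sets M" using X[OF i] by measurable
      show "u i \<in> {0..1}" using u i by blast
      fix z
      have "{\<omega> \<in> {\<omega> \<in> space M. X i \<omega> \<le> x i}. Z \<omega> \<le> z}
         = {\<omega> \<in> space M. \<forall>k\<in>{1, 2::nat}. (if k = 1 then X i else Z) \<omega> \<le> (if k = 1 then x i else z)}"
        by auto
      thus "measure M {\<omega> \<in> {\<omega> \<in> space M. X i \<omega> \<le> x i}. Z \<omega> \<le> z} = D i (u i) (cdf (distr M borel Z) z)"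
        using D_eq[OF i, of "\<lambda>k. if k = 1 then x i else z"] by (simp add: u_def G_def)
    qed
    hence margins: "AE z in P. \<forall>i\<in>{1..n}.
        cond_prob_at M Z {\<omega> \<in> space M. X i \<omega> \<le> x i} z = d i (u i) (cdf P z)"
      by (intro AE_finite_allI) auto
    have "(AE z in P. cond_prob_at M Z {\<omega> \<in> space M. \<forall>i\<in>{1..n}. X i \<omega> \<le> x i} z
          = (\<Prod>i=1..n. cond_prob_at M Z {\<omega> \<in> space M. X i \<omega> \<le> x i} z))
      \<longleftrightarrow> (AE z in P. c u (cdf P z) = ?p u (cdf P z))"
      by (rule eventually_subst) (use joint margins in \<open>eventually_elim, simp\<close>)
    also have "\<dots> \<longleftrightarrow> (AE w\<in>{0..1} in lborel. c u w = ?p u w)"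
      by (rule AE_cdf_transform[OF P Z_cont])
        (use c[OF u] p[OF u] in \<open>auto simp: unit_density_def\<close>)
    also have "\<dots> \<longleftrightarrow> factorizes u"
      unfolding factorizes_def by (rule unit_density_cong_AE[OF c[OF u] p[OF u], symmetric])
    finally show ?thesis unfolding u_def .
  qed

  have "cond_indep_given M n X Z \<longleftrightarrow> (\<forall>x. factorizes (\<lambda>i. G i (x i)))"
    unfolding cond_indep_given_def P_def[symmetric] cond_iff ..
  also have "\<dots> \<longleftrightarrow> (\<forall>u. ?cube u \<longrightarrow> factorizes u)"
  proof (intro iffI allI impI)
    fix x assume all: "\<forall>u. ?cube u \<longrightarrow> factorizes u"
    show "factorizes (\<lambda>i. G i (x i))"
      by (rule all[THEN spec, THEN mp]) (use G_cube in simp)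
  next
    fix u assume attained: "\<forall>x. factorizes (\<lambda>i. G i (x i))" and u: "?cube u"
    have interior: "factorizes v" if v: "\<And>i. i \<in> {1..n} \<Longrightarrow> v i \<in> {0<..<1}" for v
    proof -
      have "\<exists>x. G i x = v i" if i: "i \<in> {1..n}" for i
        unfolding G_def
        by (rule real_distribution.continuous_cdf_attains[OF X_dist[OF i]])
          (use X_cont[OF i] v[OF i] in \<open>auto simp: G_def\<close>)
      then obtain x where x: "\<And>i. i \<in> {1..n} \<Longrightarrow> G i (x i) = v i" by metis
      have "?p (\<lambda>i. G i (x i)) = ?p v" using x by (intro ext prod.cong) auto
      \<comment> \<open>Outside \<open>{1..Suc n}\<close> the two families may differ, but \<open>C\<close> does not see those entries.\<close>
      moreover have "C ((\<lambda>i. G i (x i))(Suc n := t)) = C (v(Suc n := t))" if t: "t \<in> {0..1}" for t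
      proof -
        have "\<bar>C ((\<lambda>i. G i (x i))(Suc n := t)) - C (v(Suc n := t))\<bar>
            \<le> (\<Sum>i=1..Suc n. \<bar>((\<lambda>i. G i (x i))(Suc n := t)) i - (v(Suc n := t)) i\<bar>)"
        proof (rule copula_lipschitz[OF cop])
          fix i assume "i \<in> {1..Suc n}"
          thus "((\<lambda>i. G i (x i))(Suc n := t)) i \<in> {0..1}" "(v(Suc n := t)) i \<in> {0..1}"
            using x[of i] v[of i] t by (auto simp: le_Suc_eq)
        qed
        also have "\<dots> = 0" using x by (intro sum.neutral) (auto simp: le_Suc_eq)
        finally show ?thesis by simp
      qed
      ultimately show ?thesis
        using attained[rule_format, of x] by (simp add: factorizes_def unit_density_def)
    qed
    have "insert (Suc n) {1..n} = {1..Suc n}" by auto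
    with cop have "copula (insert (Suc n) {1..n}) C" by simp
    thus "factorizes u"
      unfolding factorizes_def
      by (rule slice_factorization_closed_cube[OF _ _ copD d interior[unfolded factorizes_def]])
        (use u in auto)
  qed
  also have "\<dots> \<longleftrightarrow> (\<forall>u. ?cube u \<longrightarrow>
      (AE w\<in>{0..1} in lborel.
         (\<lambda>t. C (u(Suc n := t))) differentiable (at w) \<and>
         (\<forall>i\<in>{1..n}. (\<lambda>t. D i (u i) t) differentiable (at w)) \<and>
         deriv (\<lambda>t. C (u(Suc n := t))) w = (\<Prod>i=1..n. deriv (\<lambda>t. D i (u i) t) w)))"
    using deriv_iff by blast
  finally show ?thesis .
qed

end
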